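(* For every $\varepsilon>0$ and all integers $n\ge 2$, $s\ge 1$ there exist a positive integer $m$ and a non-empty set $X\subseteq\{0,1,\dots,m-1\}^n$ such that (i) for all $i\in[n]$, $AvgDeg_i(X)\ge s(n-\varepsilon)$; (ii) there is no non-empty $Y\subseteq X$ such that $MinDeg_i(Y)\ge s+1$ for all $i\in[n]$.
   Context: For a finite set $A$, $X\subseteq A^n$ and $S=\{i_1<\dots<i_k\}\subseteq[n]$, let $X_S=\{(x_{i_1},\dots,x_{i_k}):(x_1,\dots,x_n)\in X\}$. For $i\in[n]$, $G_i(X)$ is the bipartite graph with left vertex set $A$, right vertex set $X_{[n]\setminus\{i\}}$, and an edge between $a\in A$ and $(x_1,\dots,x_{i-1},x_{i+1},\dots,x_n)$ iff $(x_1,\dots,x_{i-1},a,x_{i+1},\dots,x_n)\in X$. $MinDeg_i(X)$ is the minimum degree of a right vertex of $G_i(X)$, and $AvgDeg_i(X)=|X|/|X_{[n]\setminus\{i\}}|$. *)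

theory Defs
  imports Complex_Main "HOL-Library.FuncSet"
begin

text \<open>
  Tuples in \<open>A\<^sup>n\<close> are the extensional functions \<open>{1..n} \<rightarrow>\<^sub>E A\<close>. A tuple indexed by
  \<open>S = {i\<^sub>1 < \<dots> < i\<^sub>k}\<close> is an extensional function on \<open>S\<close>, so \<open>X\<^sub>S\<close> consists of restrictions,
  and inserting \<open>a\<close> at position \<open>i\<close> into a tuple \<open>y\<close> over \<open>{1..n} - {i}\<close> is \<open>y(i := a)\<close>.
\<close>

definition coord_proj :: "nat set \<Rightarrow> (nat \<Rightarrow> 'a) set \<Rightarrow> (nat \<Rightarrow> 'a) set" where
  "coord_proj S X = (\<lambda>x. restrict x S) ` X"

record ('l, 'r) bigraph =
  left_verts :: "'l set"
  right_verts :: "'r set"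
  bi_edges :: "('l \<times> 'r) set"

definition right_degree :: "('l, 'r) bigraph \<Rightarrow> 'r \<Rightarrow> nat" where
  "right_degree G v = card {u \<in> left_verts G. (u, v) \<in> bi_edges G}"

definition coord_graph ::
  "'a set \<Rightarrow> nat \<Rightarrow> nat \<Rightarrow> (nat \<Rightarrow> 'a) set \<Rightarrow> ('a, nat \<Rightarrow> 'a) bigraph" where
  "coord_graph A n i X =
    \<lparr> left_verts = A,
      right_verts = coord_proj ({1..n} - {i}) X,
      bi_edges = {(a, y). a \<in> A \<and> y \<in> coord_proj ({1..n} - {i}) X \<and> y(i := a) \<in> X} \<rparr>"

text \<open>Only meaningful for finite non-empty \<open>X\<close>, because of \<^const>\<open>Min\<close>.\<close>

definition MinDeg :: "'a set \<Rightarrow> nat \<Rightarrow> nat \<Rightarrow> (nat \<Rightarrow> 'a) set \<Rightarrow> nat" where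
  "MinDeg A n i X =
    Min (right_degree (coord_graph A n i X) ` right_verts (coord_graph A n i X))"

definition AvgDeg :: "nat \<Rightarrow> nat \<Rightarrow> (nat \<Rightarrow> 'a) set \<Rightarrow> real" where
  "AvgDeg n i X = real (card X) / real (card (coord_proj ({1..n} - {i}) X))"

end

theory Submission
  imports Defs "HOL-Real_Asymp.Real_Asymp"
begin

text \<open>
  Let \<open>X\<close> consist of the lattice points of the positive orthant whose coordinate sum lies in
  \<open>[t, t + n s)\<close>. Its projections are simplices, of size polynomial in \<open>t\<close>, so for large \<open>t\<close> almost
  every line that meets \<open>X\<close> does so in exactly \<open>n s\<close> points.

  Cut the range of sums into \<open>n\<close> consecutive blocks of length \<open>s\<close>. There are affine functions
  \<open>w\<^sub>1, \<dots>, w\<^sub>n\<close> such that \<open>w\<^sub>i\<close> does not depend on the \<open>i\<close>-th coordinate and is strictly the largest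
  of them on the \<open>i\<close>-th block: all \<open>w\<^sub>i - w\<^sub>j\<close> are functions of the sum alone. Let \<open>x\<close> be a point of
  \<open>Y\<close> at which \<open>max\<^sub>i w\<^sub>i\<close> is maximal, say in block \<open>i\<close>. A point of \<open>Y\<close> on the line through \<open>x\<close> in
  direction \<open>i\<close> has the same value of \<open>w\<^sub>i\<close>, so in another block its maximum would be larger. Hence
  this line meets \<open>Y\<close> in block \<open>i\<close> only, in at most \<open>s\<close> points.
\<close>


section \<open>Tuples with prescribed sums\<close>

definition tuples_with_sum :: "'i set \<Rightarrow> nat set \<Rightarrow> ('i \<Rightarrow> nat) set" where
  "tuples_with_sum I B = {x \<in> I \<rightarrow>\<^sub>E UNIV. sum x I \<in> B}"

lemma sum_fun_upd_insert:
  fixes f :: "'i \<Rightarrow> 'a::comm_monoid_add"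
  assumes "finite I" and "i \<notin> I"
  shows "sum (f(i := v)) (insert i I) = v + sum f I"
proof -
  have "sum (f(i := v)) I = sum f I"
    using assms(2) by (intro sum.cong) auto
  then show ?thesis
    using assms by simp
qed

lemma tuples_with_sum_subset_PiE:
  assumes "finite I" and "\<And>b. b \<in> B \<Longrightarrow> b < m"
  shows "tuples_with_sum I B \<subseteq> I \<rightarrow>\<^sub>E {0..<m}"
proof
  fix x assume x: "x \<in> tuples_with_sum I B"
  then have "x k < m" if "k \<in> I" for k
    using member_le_sum[of k I x] that assms by (fastforce simp: tuples_with_sum_def)
  then show "x \<in> I \<rightarrow>\<^sub>E {0..<m}"
    using x by (auto simp: tuples_with_sum_def PiE_iff)
qed

lemma finite_tuples_with_sum:
  assumes "finite I" and "finite B"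
  shows "finite (tuples_with_sum I B)"
proof (rule finite_subset)
  show "tuples_with_sum I B \<subseteq> I \<rightarrow>\<^sub>E {0..<Suc (Max B)}"
    using assms by (intro tuples_with_sum_subset_PiE) (auto simp: less_Suc_eq_le)
  show "finite (I \<rightarrow>\<^sub>E {0..<Suc (Max B)})"
    using assms(1) by (simp add: finite_PiE)
qed

lemma tuples_with_sum_nonempty:
  assumes "finite I" and "i \<in> I" and "b \<in> B"
  shows "tuples_with_sum I B \<noteq> {}"
proof -
  have "restrict (\<lambda>k. if k = i then b else 0) I \<in> tuples_with_sum I B"
    using assms by (simp add: tuples_with_sum_def)
  then show ?thesis by blast
qed

lemma bij_betw_tuples_with_sum_insert:
  assumes "finite I" and "i \<notin> I"
  shows "bij_betw (\<lambda>(v, y). y(i := v)) (SIGMA v:UNIV. tuples_with_sum I ((+) v -` B))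
    (tuples_with_sum (insert i I) B)"
proof -
  define extend :: "nat \<times> ('a \<Rightarrow> nat) \<Rightarrow> 'a \<Rightarrow> nat" where "extend = (\<lambda>(v, y). y(i := v))"
  have sum_extend: "sum (extend (v, y)) (insert i I) = v + sum y I" for v y
    unfolding extend_def prod.case using assms by (rule sum_fun_upd_insert)
  have "tuples_with_sum (insert i I) B
      = {x \<in> extend ` (UNIV \<times> (I \<rightarrow>\<^sub>E UNIV)). sum x (insert i I) \<in> B}"
    unfolding tuples_with_sum_def PiE_insert_eq extend_def ..
  also have "\<dots> = extend ` (SIGMA v:UNIV. tuples_with_sum I ((+) v -` B))"
    using sum_extend by (auto simp: tuples_with_sum_def simp del: sum.insert)
  finally have "extend ` (SIGMA v:UNIV. tuples_with_sum I ((+) v -` B))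
      = tuples_with_sum (insert i I) B" ..
  moreover have "inj_on extend (SIGMA v:UNIV. tuples_with_sum I ((+) v -` B))"
    unfolding extend_def using inj_combinator[OF assms(2)]
    by (rule inj_on_subset) (auto simp: tuples_with_sum_def)
  ultimately show ?thesis
    unfolding bij_betw_def extend_def by blast
qed

lemma card_tuples_with_sum_atMost:
  assumes "finite I"
  shows "card (tuples_with_sum I {..T}) = T + card I choose card I"
  using assms
proof (induction I arbitrary: T rule: finite_induct)
  case empty
  have "tuples_with_sum ({} :: 'a set) {..T} = {\<lambda>_. undefined}"
    by (auto simp: tuples_with_sum_def)
  then show ?case by simp
next
  case (insert i I)
  have "(SIGMA v:UNIV. tuples_with_sum I ((+) v -` {..T}))
      = (SIGMA v:{..T}. tuples_with_sum I {..T - v})"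
    by (auto simp: tuples_with_sum_def)
  then have "bij_betw (\<lambda>(v, y). y(i := v)) (SIGMA v:{..T}. tuples_with_sum I {..T - v})
      (tuples_with_sum (insert i I) {..T})"
    using bij_betw_tuples_with_sum_insert[OF insert.hyps, of "{..T}"] by simp
  then have "card (tuples_with_sum (insert i I) {..T})
      = card (SIGMA v:{..T}. tuples_with_sum I {..T - v})"
    by (rule bij_betw_same_card[symmetric])
  also have "\<dots> = (\<Sum>v\<le>T. card (tuples_with_sum I {..T - v}))"
    using insert.hyps by (simp add: finite_tuples_with_sum)
  also have "\<dots> = (\<Sum>v\<le>T. T - v + card I choose card I)"
    by (simp add: insert.IH)
  also have "\<dots> = (\<Sum>v\<le>T. card I + v choose card I)"
    by (rule sum.reindex_bij_witness[where i = "\<lambda>v. T - v" and j = "\<lambda>v. T - v"])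
      (auto simp: add.commute)
  also have "\<dots> = T + card (insert i I) choose card (insert i I)"
    using insert.hyps choose_rising_sum(1)[of "card I" T] by (simp add: add.commute)
  finally show ?case .
qed

lemma card_tuples_with_sum_interval_ge:
  assumes "finite I" and "i \<notin> I"
  shows "K * (t + card I choose card I) \<le> card (tuples_with_sum (insert i I) {t..<t + K})"
proof -
  let ?extensions = "SIGMA v:UNIV. tuples_with_sum I ((+) v -` {t..<t + K})"
  let ?extend = "\<lambda>(d, y). (t - sum y I + d, y)"
  have bij: "bij_betw (\<lambda>(v, y). y(i := v)) ?extensions (tuples_with_sum (insert i I) {t..<t + K})"
    using assms by (rule bij_betw_tuples_with_sum_insert)
  then have finite_extensions: "finite ?extensions"
    using assms(1) by (simp add: bij_betw_finite finite_tuples_with_sum)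
  have inj: "inj_on ?extend ({..<K} \<times> tuples_with_sum I {..t})"
    by (auto intro: inj_onI)
  have "K * (t + card I choose card I) = card ({..<K} \<times> tuples_with_sum I {..t})"
    by (simp add: card_cartesian_product card_tuples_with_sum_atMost assms(1))
  also have "\<dots> \<le> card ?extensions"
    by (rule card_inj_on_le[OF inj _ finite_extensions]) (auto simp: tuples_with_sum_def)
  also have "\<dots> = card (tuples_with_sum (insert i I) {t..<t + K})"
    using bij by (rule bij_betw_same_card)
  finally show ?thesis .
qed

lemma card_line_tuples_with_sum_le:
  assumes "finite I" and "i \<in> I" and "finite B"
    and line: "\<And>a. a \<in> L \<Longrightarrow> x(i := a) \<in> tuples_with_sum I B"
  shows "card L \<le> card B"
proof (rule card_inj_on_le)
  have sum_eq: "sum (x(i := a)) I = a + sum x (I - {i})" for a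
    using sum_fun_upd_insert[of "I - {i}" i] assms by (simp add: insert_absorb)
  show "inj_on (\<lambda>a. a + sum x (I - {i})) L"
    by (rule inj_onI) simp
  show "(\<lambda>a. a + sum x (I - {i})) ` L \<subseteq> B"
    using line by (auto simp: tuples_with_sum_def sum_eq[symmetric])
qed fact


section \<open>Average degrees\<close>

lemma coord_proj_tuples_with_sum:
  assumes "finite I" and "i \<notin> I"
  shows "coord_proj I (tuples_with_sum (insert i I) B) = tuples_with_sum I {u. \<exists>b\<in>B. u \<le> b}"
proof -
  have restrict_extension: "restrict (y(i := v)) I = y" if "y \<in> tuples_with_sum I C" for v y C
    using that assms(2) by (auto simp: tuples_with_sum_def fun_eq_iff PiE_iff extensional_def)
  have "coord_proj I (tuples_with_sum (insert i I) B)
      = (\<Union>v. (\<lambda>y. restrict (y(i := v)) I) ` tuples_with_sum I ((+) v -` B))"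
    unfolding coord_proj_def
      bij_betw_imp_surj_on[OF bij_betw_tuples_with_sum_insert[OF assms], symmetric]
    by force
  also have "\<dots> = (\<Union>v. tuples_with_sum I ((+) v -` B))"
    using restrict_extension by simp
  also have "\<dots> = tuples_with_sum I {u. \<exists>b\<in>B. u \<le> b}"
    by (force simp: tuples_with_sum_def le_iff_add add.commute)
  finally show ?thesis .
qed

lemma AvgDeg_tuples_with_sum_ge:
  assumes "i \<in> {1..n}" and "K > 0"
  shows "K * ((t + (n - 1) choose (n - 1)) / (t + (K - 1) + (n - 1) choose (n - 1)))
    \<le> AvgDeg n i (tuples_with_sum {1..n} {t..<t + K})"
proof -
  define I where "I = {1..n} - {i}"
  have I: "finite I" "i \<notin> I" "insert i I = {1..n}" "card I = n - 1"
    using assms(1) by (auto simp: I_def)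
  have "{u. \<exists>b\<in>{t..<t + K}. u \<le> b} = {..t + (K - 1)}"
    using assms(2) by force
  then have "card (coord_proj I (tuples_with_sum {1..n} {t..<t + K}))
      = t + (K - 1) + (n - 1) choose (n - 1)"
    using coord_proj_tuples_with_sum[OF I(1,2)] card_tuples_with_sum_atMost[OF I(1)]
    by (simp add: I(3,4))
  moreover have "real (K * (t + (n - 1) choose (n - 1)))
      \<le> real (card (tuples_with_sum {1..n} {t..<t + K}))"
    using card_tuples_with_sum_interval_ge[OF I(1,2)] unfolding I(3,4) of_nat_le_iff .
  ultimately show ?thesis
    unfolding AvgDeg_def I_def[symmetric] by (simp add: divide_right_mono)
qed

lemma binomial_shift_ratio_tendsto_1:
  "(\<lambda>t. real (t + k choose k) / real (t + d + k choose k)) \<longlonglongrightarrow> 1"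
proof (induction k)
  case 0
  show ?case by simp
next
  case (Suc k)
  have binomial_Suc: "real (t + Suc k choose Suc k)
      = real (t + k choose k) * ((real t + (k + 1)) / (k + 1))" for t
    using Suc_times_binomial_eq[of "t + k" k, THEN arg_cong[where f = real]]
    by (simp add: field_simps del: binomial_Suc_Suc)
  have "(\<lambda>t. (real t + (k + 1)) / (real t + (d + k + 1))) \<longlonglongrightarrow> 1"
    by real_asymp
  from tendsto_mult[OF Suc.IH this]
  have "(\<lambda>t. real (t + k choose k) / real (t + d + k choose k)
      * ((real t + (k + 1)) / (real t + (d + k + 1)))) \<longlonglongrightarrow> 1"
    by (simp only: mult_1)
  also have "(\<lambda>t. real (t + k choose k) / real (t + d + k choose k)
      * ((real t + (k + 1)) / (real t + (d + k + 1))))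
    = (\<lambda>t. real (t + Suc k choose Suc k) / real (t + d + Suc k choose Suc k))"
    unfolding binomial_Suc by (simp add: fun_eq_iff add_ac)
  finally show ?case .
qed

lemma eventually_AvgDeg_tuples_with_sum_ge:
  assumes "K > 0" and "c < K"
  shows "\<forall>\<^sub>F t in sequentially. \<forall>i\<in>{1..n}. c \<le> AvgDeg n i (tuples_with_sum {1..n} {t..<t + K})"
proof -
  let ?ratio = "\<lambda>t. (t + (n - 1) choose (n - 1)) / (t + (K - 1) + (n - 1) choose (n - 1))"
  have "(\<lambda>t. K * ?ratio t) \<longlonglongrightarrow> real K * 1"
    by (rule tendsto_mult_left[OF binomial_shift_ratio_tendsto_1])
  then have "\<forall>\<^sub>F t in sequentially. c < K * ?ratio t"
    by (rule order_tendstoD(1)) (use assms(2) in simp)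
  then show ?thesis
  proof (rule eventually_mono, intro ballI)
    fix t i assume "c < K * ?ratio t" and "i \<in> {1..n}"
    then show "c \<le> AvgDeg n i (tuples_with_sum {1..n} {t..<t + K})"
      using AvgDeg_tuples_with_sum_ge[OF _ assms(1), of i n t] by linarith
  qed
qed


section \<open>Minimum degrees\<close>

lemma MinDeg_le_card_line:
  assumes "finite X" and "X \<subseteq> extensional {1..n}" and "x \<in> X"
  shows "MinDeg A n i X \<le> card {a \<in> A. x(i := a) \<in> X}"
proof -
  let ?G = "coord_graph A n i X" and ?y = "restrict x ({1..n} - {i})"
  have "?y(i := a) = x(i := a)" for a
    using assms(2,3) by (auto simp: fun_eq_iff extensional_def)
  then have degree: "right_degree ?G ?y = card {a \<in> A. x(i := a) \<in> X}"
    using assms(3)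
    by (auto simp: right_degree_def coord_graph_def coord_proj_def intro!: arg_cong[where f = card]
        simp del: restrict_upd)
  have "?y \<in> right_verts ?G" "finite (right_verts ?G)"
    using assms(1,3) by (auto simp: coord_graph_def coord_proj_def)
  then have "MinDeg A n i X \<le> right_degree ?G ?y"
    unfolding MinDeg_def by (intro Min_le) auto
  then show ?thesis
    unfolding degree .
qed

lemma ex_MinDeg_le_if_dominant_weights:
  fixes w :: "nat \<Rightarrow> (nat \<Rightarrow> 'a) \<Rightarrow> 'b::linorder" and dir :: "(nat \<Rightarrow> 'a) \<Rightarrow> nat"
  assumes Y: "finite Y" "Y \<noteq> {}" "Y \<subseteq> extensional {1..n}"
    and dir_mem: "\<And>x. x \<in> Y \<Longrightarrow> dir x \<in> {1..n}"
    and independent: "\<And>i x a. w i (x(i := a)) = w i x"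
    and dominant: "\<And>x j. x \<in> Y \<Longrightarrow> j \<in> {1..n} \<Longrightarrow> j \<noteq> dir x \<Longrightarrow> w j x < w (dir x) x"
    and few: "\<And>x i. x \<in> Y \<Longrightarrow> i \<in> {1..n} \<Longrightarrow>
      card {a \<in> A. x(i := a) \<in> Y \<and> dir (x(i := a)) = i} \<le> s"
  shows "\<exists>i\<in>{1..n}. MinDeg A n i Y \<le> s"
proof -
  obtain x where x: "x \<in> Y" "Max ((\<lambda>y. w (dir y) y) ` Y) = w (dir x) x"
    using obtains_MAX[OF Y(1,2)] .
  define i where "i = dir x"
  have "dir (x(i := a)) = i" if "x(i := a) \<in> Y" for a
  proof (rule ccontr)
    assume "dir (x(i := a)) \<noteq> i"
    then have "w i (x(i := a)) < w (dir (x(i := a))) (x(i := a))"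
      using dominant[OF that] dir_mem[OF x(1)] by (simp add: i_def)
    also have "\<dots> \<le> w i x"
      using that Y(1) unfolding i_def x(2)[symmetric] by simp
    finally show False
      by (simp add: independent)
  qed
  then have "{a \<in> A. x(i := a) \<in> Y} = {a \<in> A. x(i := a) \<in> Y \<and> dir (x(i := a)) = i}"
    by blast
  then have "MinDeg A n i Y \<le> s"
    using MinDeg_le_card_line[OF Y(1,3) x(1), of A i] few[OF x(1), of i] dir_mem[OF x(1)]
    by (simp add: i_def)
  then show ?thesis
    using dir_mem[OF x(1)] by (auto simp: i_def)
qed

definition sum_block :: "nat \<Rightarrow> nat \<Rightarrow> nat \<Rightarrow> nat set" where
  "sum_block s t i = {t + (i - 1) * s..<t + i * s}"

lemma card_sum_block: "i \<ge> 1 \<Longrightarrow> card (sum_block s t i) = s"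
  by (cases i) (auto simp: sum_block_def)

lemma ex_mem_sum_block:
  assumes "u \<in> {t..<t + n * s}"
  shows "\<exists>i\<in>{1..n}. u \<in> sum_block s t i"
proof
  let ?i = "Suc ((u - t) div s)"
  have "s > 0"
    using assms by (cases s) auto
  then have "(?i - 1) * s \<le> u - t" "u - t < ?i * s"
    using dividend_less_div_times[of s "u - t"] by simp_all
  then show "u \<in> sum_block s t ?i"
    using assms unfolding sum_block_def atLeastLessThan_iff by linarith
  show "?i \<in> {1..n}"
    using assms \<open>s > 0\<close> by (auto simp: Suc_le_eq div_less_iff_less_mult)
qed

text \<open>
  Twice the weight \<open>w\<^sub>i\<close>, to stay within the integers. As a function of the coordinate sum \<open>u\<close>,
  \<open>w\<^sub>i - w\<^bsub>i+1\<^esub>\<close> changes sign at \<open>u = t + i s - 1/2\<close>, halfway between the last element of block \<open>i\<close>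
  and the first one of block \<open>i + 1\<close>.
\<close>

definition block_weight :: "nat \<Rightarrow> nat \<Rightarrow> nat \<Rightarrow> nat \<Rightarrow> (nat \<Rightarrow> nat) \<Rightarrow> int" where
  "block_weight n s t i x =
    (\<Sum>k\<in>{1..n}. 2 * (int i - int k) * int (x k))
      - int i * (2 * int t - 1) - int s * int i * (int i - 1)"

lemma block_weight_fun_upd: "block_weight n s t i (x(i := a)) = block_weight n s t i x"
  unfolding block_weight_def by (auto intro: sum.cong)

lemma block_weight_diff:
  "block_weight n s t i x - block_weight n s t j x
    = (int i - int j) * (2 * (int (sum x {1..n}) - int t) + 1 - int s * (int i + int j - 1))"
proof -
  have "(\<Sum>k\<in>{1..n}. 2 * (int i - int k) * int (x k))
      - (\<Sum>k\<in>{1..n}. 2 * (int j - int k) * int (x k))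
      = 2 * (int i - int j) * int (sum x {1..n})"
    unfolding sum_subtractf[symmetric] of_nat_sum sum_distrib_left
    by (intro sum.cong) (auto simp: algebra_simps)
  then show ?thesis
    unfolding block_weight_def by (simp add: algebra_simps)
qed

lemma block_weight_less:
  assumes "i \<ge> 1" and "sum x {1..n} \<in> sum_block s t i" and "j \<noteq> i"
  shows "block_weight n s t j x < block_weight n s t i x"
proof -
  define u where "u = int (sum x {1..n}) - int t"
  have u: "int s * (int i - 1) \<le> u" "u < int s * int i"
    using assms(1,2)
    by (cases i; simp add: u_def sum_block_def algebra_simps del: of_nat_sum
        flip: of_nat_mult of_nat_add)+
  have "0 < (int i - int j) * (2 * u + 1 - int s * (int i + int j - 1))"
  proof (cases "i < j")
    case True
    then have "int s * (2 * int i) \<le> int s * (int i + int j - 1)"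
      by (intro mult_left_mono) auto
    then show ?thesis
      using True u by (intro mult_neg_neg) auto
  next
    case False
    then have "int s * (int i + int j - 1) \<le> int s * (2 * (int i - 1))"
      using assms(3) by (intro mult_left_mono) auto
    also have "\<dots> = 2 * (int s * (int i - 1))"
      by simp
    finally show ?thesis
      using False assms(3) u by (intro mult_pos_pos) linarith+
  qed
  then show ?thesis
    using block_weight_diff[of n s t i x j] by (simp add: u_def)
qed

lemma ex_MinDeg_tuples_with_sum_le:
  assumes "Y \<noteq> {}" and "Y \<subseteq> tuples_with_sum {1..n} {t..<t + n * s}"
  shows "\<exists>i\<in>{1..n}. MinDeg A n i Y \<le> s"
proof -
  have sum_mem: "sum x {1..n} \<in> {t..<t + n * s}" if "x \<in> Y" for x
    using that assms(2) by (auto simp: tuples_with_sum_def)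
  obtain dir where dir:
    "\<And>x. x \<in> Y \<Longrightarrow> dir x \<in> {1..n} \<and> sum x {1..n} \<in> sum_block s t (dir x)"
    using ex_mem_sum_block[OF sum_mem] by metis
  show ?thesis
  proof (rule ex_MinDeg_le_if_dominant_weights)
    show "finite Y"
      using assms(2) by (rule finite_subset) (simp add: finite_tuples_with_sum)
    show "Y \<noteq> {}" by fact
    show "Y \<subseteq> extensional {1..n}"
      using assms(2) by (auto simp: tuples_with_sum_def PiE_def)
    show "dir x \<in> {1..n}" if "x \<in> Y" for x
      using dir[OF that] ..
    show "block_weight n s t i (x(i := a)) = block_weight n s t i x" for i x a
      by (rule block_weight_fun_upd)
    show "block_weight n s t j x < block_weight n s t (dir x) x" if "x \<in> Y" "j \<noteq> dir x" for x j
      using dir[OF that(1)] that(2) by (intro block_weight_less) auto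
    show "card {a \<in> A. x(i := a) \<in> Y \<and> dir (x(i := a)) = i} \<le> s" if "i \<in> {1..n}" for x i
    proof -
      have "x(i := a) \<in> tuples_with_sum {1..n} (sum_block s t i)"
        if "x(i := a) \<in> Y" "dir (x(i := a)) = i" for a
        using that dir[OF that(1)] assms(2) by (auto simp: tuples_with_sum_def)
      then have "card {a \<in> A. x(i := a) \<in> Y \<and> dir (x(i := a)) = i} \<le> card (sum_block s t i)"
        using that
        by (intro card_line_tuples_with_sum_le[where I = "{1..n}" and i = i and x = x])
          (auto simp: sum_block_def)
      then show ?thesis
        using that by (simp add: card_sum_block)
    qed
  qed
qed

theorem theorem3:
  fixes \<epsilon> :: real and n s :: nat
  assumes "\<epsilon> > 0" and "n \<ge> 2" and "s \<ge> 1"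
  shows "\<exists>(m::nat) (X :: (nat \<Rightarrow> nat) set).
           m > 0 \<and> X \<noteq> {} \<and> X \<subseteq> ({1..n} \<rightarrow>\<^sub>E {0..<m}) \<and>
           (\<forall>i\<in>{1..n}. AvgDeg n i X \<ge> real s * (real n - \<epsilon>)) \<and>
           \<not> (\<exists>Y. Y \<noteq> {} \<and> Y \<subseteq> X \<and> (\<forall>i\<in>{1..n}. MinDeg {0..<m} n i Y \<ge> s + 1))"
proof -
  have "n * s > 0" "s * (n - \<epsilon>) < n * s"
    using assms by (simp_all add: algebra_simps)
  then have "\<forall>\<^sub>F t in sequentially. \<forall>i\<in>{1..n}.
      s * (n - \<epsilon>) \<le> AvgDeg n i (tuples_with_sum {1..n} {t..<t + n * s})"
    by (rule eventually_AvgDeg_tuples_with_sum_ge)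
  then obtain t where AvgDeg: "\<And>i. i \<in> {1..n} \<Longrightarrow>
      s * (n - \<epsilon>) \<le> AvgDeg n i (tuples_with_sum {1..n} {t..<t + n * s})"
    using eventually_happens'[OF sequentially_bot] by blast
  show ?thesis
  proof (intro exI conjI ballI)
    let ?X = "tuples_with_sum {1..n} {t..<t + n * s}"
    show "0 < t + n * s"
      using \<open>n * s > 0\<close> by simp
    show "?X \<noteq> {}"
      using \<open>n \<ge> 2\<close> \<open>n * s > 0\<close> by (intro tuples_with_sum_nonempty[of _ 1 t]) auto
    show "?X \<subseteq> {1..n} \<rightarrow>\<^sub>E {0..<t + n * s}"
      by (rule tuples_with_sum_subset_PiE) auto
    show "s * (n - \<epsilon>) \<le> AvgDeg n i ?X" if "i \<in> {1..n}" for i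
      using that by (rule AvgDeg)
    show "\<not> (\<exists>Y. Y \<noteq> {} \<and> Y \<subseteq> ?X \<and> (\<forall>i\<in>{1..n}. MinDeg {0..<t + n * s} n i Y \<ge> s + 1))"
      using ex_MinDeg_tuples_with_sum_le by (metis Suc_eq_plus1 not_less_eq_eq)
  qed
qed

end
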